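(* Let $\mathcal{F}_n=\{E_1|H_1,\ldots,E_n|H_n\}$ be a p-consistent family of $n$ conditional events and $E|H$ a further conditional event. For a real number $z$ let $\mathcal{P}=(1,\ldots,1,z)$ denote the assessment on $\mathcal{F}_n\cup\{E|H\}$ with $P(E_i|H_i)=1$ for $i=1,\ldots,n$ and $P(E|H)=z$. Then exactly one of the following statements is true: $(a_1)$ $\mathcal{P}=(1,\ldots,1,z)$ is coherent if and only if $z=1$; $(a_2)$ $\mathcal{P}=(1,\ldots,1,z)$ is coherent for every $z\in[0,1]$; $(a_3)$ $\mathcal{P}=(1,\ldots,1,z)$ is coherent if and only if $z=0$.
   Context: Events are elements of a Boolean algebra with sure event $\Omega$ and impossible event $\emptyset$; $AB$ is conjunction, $A\vee B$ disjunction, $A^c$ negation, $A\subseteq B$ logical implication; an event is identified with its indicator. A conditional event $E|H$ is given by events $E,H$ with $H\neq\emptyset$; it is true if $EH$ is true, false if $E^cH$ is true, void if $H^c$ is true. Coherence. An assessment $(p_1,\ldots,p_n)$ of real numbers, with $p_i=P(E_i|H_i)$, on a finite list of conditional events $E_1|H_1,\ldots,E_n|H_n$ is coherent if for every nonempty $J\subseteq\{1,\ldots,n\}$ and all real numbers $s_j$ ($j\in J$), the random gain $\mathcal{G}=\sum_{j\in J}s_jH_j(E_j-p_j)$, restricted to $\bigvee_{j\in J}H_j$ (i.e. considering its finitely many values on the possible outcomes implying $\bigvee_{j\in J}H_j$), satisfies $\min\mathcal{G}\le 0\le\max\mathcal{G}$. Assessments on $\mathcal{F}_n\cup\{E|H\}$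 are understood on the list of $n+1$ conditional events $E_1|H_1,\ldots,E_n|H_n,E|H$, even if $E|H=E_i|H_i$ for some $i$. p-consistency. A family $\{E_i|H_i: i=1,\ldots,n\}$ is p-consistent if for every $(\alpha_1,\ldots,\alpha_n)\in[0,1)^n$ there is a coherent assessment $(p_1,\ldots,p_n)$ on it with $p_i\ge\alpha_i$ for all $i$. *)

theory Defs
  imports Complex_Main
begin

text \<open>
  A pair \<open>(E, H)\<close> stands for the conditional event \<open>E|H\<close>.
\<close>

type_synonym 'a cond_event = "'a \<times> 'a"

definition is_cond_event :: "'a::boolean_algebra cond_event \<Rightarrow> bool" where
  "is_cond_event c \<longleftrightarrow> snd c \<noteq> bot"

text \<open>
  The possible outcomes relative to a finite nonempty set \<open>A\<close> of events: the nonzero conjunctions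
  obtained by affirming the events of a subset \<open>T\<close> and negating the remaining ones, i.e. the atoms
  of the subalgebra generated by \<open>A\<close>. Hence an outcome \<open>C\<close> implies either \<open>X\<close> or
  \<open>- X\<close> for every \<open>X\<close> in \<open>A\<close>.
\<close>

definition outcomes :: "'a::boolean_algebra set \<Rightarrow> 'a set" where
  "outcomes A = {C. C \<noteq> bot \<and> (\<exists>T\<subseteq>A. C = Inf_fin (T \<union> uminus ` (A - T)))}"

text \<open>The value taken by (the indicator of) the event \<open>X\<close> on the outcome \<open>C\<close>.\<close>

definition ind :: "'a::boolean_algebra \<Rightarrow> 'a \<Rightarrow> real" where
  "ind X C = of_bool (C \<le> X)"

definition gain ::
  "'a::boolean_algebra cond_event list \<Rightarrow> real list \<Rightarrow> nat set \<Rightarrow> (nat \<Rightarrow> real) \<Rightarrow> 'a \<Rightarrow> real" where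
  "gain F p J s C = (\<Sum>j\<in>J. s j * ind (snd (F ! j)) C * (ind (fst (F ! j)) C - p ! j))"

definition restricted_gains ::
  "'a::boolean_algebra cond_event list \<Rightarrow> real list \<Rightarrow> nat set \<Rightarrow> (nat \<Rightarrow> real) \<Rightarrow> real set" where
  "restricted_gains F p J s =
     gain F p J s ` {C \<in> outcomes ((\<lambda>j. fst (F ! j)) ` J \<union> (\<lambda>j. snd (F ! j)) ` J).
                       C \<le> Sup_fin ((\<lambda>j. snd (F ! j)) ` J)}"

definition coherent :: "'a::boolean_algebra cond_event list \<Rightarrow> real list \<Rightarrow> bool" where
  "coherent F p \<longleftrightarrow> length p = length F \<and>
     (\<forall>J s. J \<subseteq> {..<length F} \<and> J \<noteq> {} \<longrightarrow>
        Min (restricted_gains F p J s) \<le> 0 \<and> 0 \<le> Max (restricted_gains F p J s))"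

definition p_consistent :: "'a::boolean_algebra cond_event list \<Rightarrow> bool" where
  "p_consistent F \<longleftrightarrow>
     (\<forall>\<alpha>::real list. length \<alpha> = length F \<and> (\<forall>i<length F. \<alpha> ! i \<in> {0..<1}) \<longrightarrow>
        (\<exists>p. coherent F p \<and> (\<forall>i<length F. \<alpha> ! i \<le> p ! i)))"

end

theory Submission
  imports Defs
begin

text \<open>
  Coherence of an assessment whose first \<open>n\<close> entries are 1 is a purely logical matter. Such an
  entry contributes \<open>- s j\<close> to the gain where \<open>E\<^sub>j|H\<^sub>j\<close> is false and nothing elsewhere, so a bettor can
  punish every falsification at will, by large stakes, and gains or loses nothing on outcomes that
  falsify none of the chosen conditional events. Only these outcomes matter.

  First, \<open>p\<close>-consistency forces every nonempty \<open>J\<close> to have an outcome that makes some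
  \<open>H\<^sub>j\<close> true and falsifies none of the \<open>E\<^sub>j|H\<^sub>j\<close>: otherwise unit stakes lose on every
  outcome as soon as all the probabilities are close enough to 1 (\<open>p_consistent_imp_active\<close>).

  Next, fix a set \<open>J\<close> of indices below \<open>n\<close> and bet on it together with \<open>E|H\<close>. An outcome that
  falsifies nothing in \<open>J\<close>, makes some \<open>H\<^sub>j\<close> true and makes \<open>E|H\<close> void gives gain 0, and then
  \<open>J\<close> puts no constraint on \<open>z\<close>. Without such an outcome, all that remains is a bet on \<open>E|H\<close>
  whose possible results are the truth values of \<open>E|H\<close> on the outcomes that falsify nothing in
  \<open>J\<close>: if both values occur, \<open>z\<close> may be anything in \<open>[0,1]\<close>; if only one occurs, \<open>z\<close> must be
  equal to it (\<open>coherent_ones_iff\<close>).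

  So the three cases are that no \<open>J\<close> constrains \<open>z\<close>, that some \<open>J\<close> forces \<open>z = 1\<close>, or that
  some \<open>J\<close> forces \<open>z = 0\<close>. A set \<open>J\<close> of the second kind and a set \<open>K\<close> of the third kind cannot
  coexist: an outcome for \<open>J \<union> K\<close> that falsifies nothing would have to make
  \<open>E|H\<close> true because of \<open>J\<close> and false because of \<open>K\<close> (\<open>compatible_dichotomy\<close>).
\<close>

section \<open>Coherence in terms of cells\<close>

text \<open>
  The outcomes used in the definition of coherence depend on the subset of conditional events
  that is bet on. A cell need not be an atom of a subalgebra, it only has to decide the events of
  \<open>A\<close>, so cells for one large \<open>A\<close> serve all the subsets at once.
\<close>

definition cells :: "'a::boolean_algebra set \<Rightarrow> 'a set" where
  "cells A = {D. D \<noteq> bot \<and> (\<forall>X\<in>A. D \<le> X \<or> D \<le> - X)}"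

lemma not_le_both:
  fixes D X :: "'a::boolean_algebra"
  assumes "D \<noteq> bot" "D \<le> X"
  shows "\<not> D \<le> - X"
proof
  assume "D \<le> - X"
  with assms(2) have "D \<le> inf X (- X)" by (rule inf_greatest)
  with assms(1) show False by (simp add: bot_unique)
qed

lemma cells_nonbot: "D \<in> cells A \<Longrightarrow> D \<noteq> bot"
  by (simp add: cells_def)

lemma cells_decide: "D \<in> cells A \<Longrightarrow> X \<in> A \<Longrightarrow> D \<le> - X \<longleftrightarrow> \<not> D \<le> X"
  using not_le_both by (auto simp: cells_def)

lemma cell_below:
  assumes "finite A" "D \<noteq> bot"
  shows "\<exists>D'\<in>cells A. D' \<le> D"
  using assms
proof (induction A)
  case empty
  then show ?case by (auto simp: cells_def)
next
  case (insert X A)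
  then obtain D' where D': "D' \<in> cells A" "D' \<le> D" by blast
  have split: "D' = sup (inf D' X) (inf D' (- X))"
    by (metis inf_sup_distrib1 inf_top_right sup_compl_top)
  then have "inf D' X \<noteq> bot \<or> inf D' (- X) \<noteq> bot"
    using cells_nonbot[OF D'(1)] by fastforce
  then show ?case
  proof
    assume "inf D' X \<noteq> bot"
    then have "inf D' X \<in> cells (insert X A)"
      using D'(1) by (auto simp: cells_def intro: le_infI1)
    then show ?thesis using D'(2) by (blast intro: le_infI1)
  next
    assume "inf D' (- X) \<noteq> bot"
    then have "inf D' (- X) \<in> cells (insert X A)"
      using D'(1) by (auto simp: cells_def intro: le_infI1)
    then show ?thesis using D'(2) by (blast intro: le_infI1)
  qed
qed

lemma finite_outcomes:
  assumes "finite A"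
  shows "finite (outcomes A)"
proof -
  have "outcomes A \<subseteq> (\<lambda>T. Inf_fin (T \<union> uminus ` (A - T))) ` Pow A"
    by (auto simp: outcomes_def)
  then show ?thesis using assms finite_subset by blast
qed

lemma outcomes_subset_cells:
  assumes "finite A"
  shows "outcomes A \<subseteq> cells A"
proof
  fix C assume "C \<in> outcomes A"
  then obtain T where C: "C \<noteq> bot" "T \<subseteq> A" "C = Inf_fin (T \<union> uminus ` (A - T))"
    by (auto simp: outcomes_def)
  have fin: "finite (T \<union> uminus ` (A - T))" using assms C(2) finite_subset by auto
  have "C \<le> X \<or> C \<le> - X" if "X \<in> A" for X
    using Inf_fin.coboundedI[OF fin] C(3) that by blast
  then show "C \<in> cells A" using C(1) by (simp add: cells_def)
qed

lemma cell_below_outcome: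
  assumes "finite A" "A \<noteq> {}" "D \<in> cells A"
  shows "\<exists>C\<in>outcomes A. D \<le> C"
proof -
  define T where "T = {X\<in>A. D \<le> X}"
  have fin: "finite (T \<union> uminus ` (A - T))" and ne: "T \<union> uminus ` (A - T) \<noteq> {}"
    using assms by (auto simp: T_def)
  have "D \<le> Y" if "Y \<in> T \<union> uminus ` (A - T)" for Y
    using that assms(3) by (auto simp: T_def cells_def)
  then have le: "D \<le> Inf_fin (T \<union> uminus ` (A - T))"
    using Inf_fin.boundedI[OF fin ne] by blast
  moreover have "Inf_fin (T \<union> uminus ` (A - T)) \<noteq> bot"
    using le cells_nonbot[OF assms(3)] by (metis bot_unique)
  moreover have "T \<subseteq> A" by (auto simp: T_def)
  ultimately show ?thesis
    by (intro bexI[of _ "Inf_fin (T \<union> uminus ` (A - T))"]) (auto simp: outcomes_def)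
qed

lemma ind_eq_of_cells:
  assumes "D \<in> cells A" "C \<in> cells A" "D \<le> C" "X \<in> A"
  shows "ind X D = ind X C"
proof -
  have "D \<le> X \<longleftrightarrow> C \<le> X"
    using assms cells_decide order_trans by metis
  then show ?thesis by (simp add: ind_def)
qed

lemma gain_eq_of_cells:
  assumes "D \<in> cells A" "C \<in> cells A" "D \<le> C"
    and "\<And>j. j \<in> J \<Longrightarrow> fst (F ! j) \<in> A \<and> snd (F ! j) \<in> A"
  shows "gain F p J s D = gain F p J s C"
  unfolding gain_def
  by (intro sum.cong refl) (use assms ind_eq_of_cells[OF assms(1-3)] in simp)

lemma cells_antimono: "B \<subseteq> A \<Longrightarrow> cells A \<subseteq> cells B"
  by (auto simp: cells_def)

text \<open>
  Each cell lies below an outcome and each outcome has a cell below it. Both decide the events of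
  \<open>J\<close> in the same way, so they give the same gain.
\<close>

lemma restricted_gains_eq_cells:
  assumes "finite A" "finite J" "J \<noteq> {}"
    and A: "\<And>j. j \<in> J \<Longrightarrow> fst (F ! j) \<in> A \<and> snd (F ! j) \<in> A"
  shows "restricted_gains F p J s =
    gain F p J s ` {D \<in> cells A. \<exists>j\<in>J. D \<le> snd (F ! j)}"
proof -
  define B where "B = (\<lambda>j. fst (F ! j)) ` J \<union> (\<lambda>j. snd (F ! j)) ` J"
  define S where "S = (\<lambda>j. snd (F ! j)) ` J"
  have B: "finite B" "B \<noteq> {}" "B \<subseteq> A" and S: "finite S" "S \<noteq> {}"
    and JB: "\<And>j. j \<in> J \<Longrightarrow> fst (F ! j) \<in> B \<and> snd (F ! j) \<in> B"
    using assms by (auto simp: B_def S_def)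
  have RG: "restricted_gains F p J s = gain F p J s ` {C \<in> outcomes B. C \<le> Sup_fin S}"
    by (simp add: restricted_gains_def B_def S_def)
  show ?thesis unfolding RG
  proof (intro subset_antisym image_subsetI)
    fix C assume "C \<in> {C \<in> outcomes B. C \<le> Sup_fin S}"
    then have C: "C \<in> cells B" "C \<le> Sup_fin S"
      using outcomes_subset_cells[OF B(1)] by auto
    obtain D where D: "D \<in> cells A" "D \<le> C"
      using cell_below[OF assms(1) cells_nonbot[OF C(1)]] by blast
    have DB: "D \<in> cells B" using D(1) cells_antimono[OF B(3)] by blast
    have "\<exists>j\<in>J. D \<le> snd (F ! j)"
    proof (rule ccontr)
      assume "\<not> ?thesis"
      then have "D \<le> - snd (F ! j)" if "j \<in> J" for j
        using cells_decide[OF D(1)] A that by blast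
      then have "X \<le> - D" if "X \<in> S" for X
        using that by (auto simp: S_def intro: compl_le_swap1)
      then have "Sup_fin S \<le> - D" by (rule Sup_fin.boundedI[OF S])
      then have "D \<le> - D" using C(2) D(2) by order
      then show False using not_le_both[OF cells_nonbot[OF D(1)]] by blast
    qed
    moreover have "gain F p J s D = gain F p J s C"
      using gain_eq_of_cells[OF DB C(1) D(2)] JB by blast
    ultimately show "gain F p J s C \<in> gain F p J s ` {D \<in> cells A. \<exists>j\<in>J. D \<le> snd (F ! j)}"
      using D(1) by (intro image_eqI[of _ _ D]) simp_all
  next
    fix D assume "D \<in> {D \<in> cells A. \<exists>j\<in>J. D \<le> snd (F ! j)}"
    then obtain j where D: "D \<in> cells A" and j: "j \<in> J" "D \<le> snd (F ! j)" by blast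
    have DB: "D \<in> cells B" using D(1) cells_antimono[OF B(3)] by blast
    obtain C where C: "C \<in> outcomes B" "D \<le> C"
      using cell_below_outcome[OF B(1,2) DB] by blast
    have CB: "C \<in> cells B" using C(1) outcomes_subset_cells[OF B(1)] by blast
    have "C \<le> snd (F ! j)"
    proof (rule ccontr)
      assume "\<not> C \<le> snd (F ! j)"
      then have "D \<le> - snd (F ! j)" 
        using cells_decide[OF CB] JB[OF j(1)] C(2) order_trans by blast
      then show False using not_le_both[OF cells_nonbot[OF D] j(2)] by blast
    qed
    also have "snd (F ! j) \<le> Sup_fin S"
      using j(1) by (intro Sup_fin.coboundedI S) (simp add: S_def)
    finally have "C \<le> Sup_fin S" .
    moreover have "gain F p J s D = gain F p J s C"
      using gain_eq_of_cells[OF DB CB C(2)] JB by blast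
    ultimately show "gain F p J s D \<in> gain F p J s ` {C \<in> outcomes B. C \<le> Sup_fin S}"
      using C(1) by force
  qed
qed

lemma gain_uminus: "gain F p J (\<lambda>j. - s j) C = - gain F p J s C"
  by (simp add: gain_def sum_negf)

text \<open>
  Replacing the stakes by their opposites exchanges the two inequalities in the definition of
  coherence, so one of them, for all stakes, is enough.
\<close>

lemma coherent_iff_cells:
  assumes "finite A" and ce: "\<forall>c\<in>set F. is_cond_event c"
    and A: "\<forall>c\<in>set F. fst c \<in> A \<and> snd c \<in> A"
  shows "coherent F p \<longleftrightarrow> length p = length F \<and>
    (\<forall>J s. J \<subseteq> {..<length F} \<and> J \<noteq> {} \<longrightarrow>
      (\<exists>D\<in>cells A. (\<exists>j\<in>J. D \<le> snd (F ! j)) \<and> 0 \<le> gain F p J s D))"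
proof -
  let ?W = "\<lambda>J. {D \<in> cells A. \<exists>j\<in>J. D \<le> snd (F ! j)}"
  have main: "(Min (restricted_gains F p J s) \<le> 0 \<longleftrightarrow> (\<exists>D\<in>?W J. 0 \<le> gain F p J (\<lambda>j. - s j) D))
      \<and> (0 \<le> Max (restricted_gains F p J s) \<longleftrightarrow> (\<exists>D\<in>?W J. 0 \<le> gain F p J s D))"
    if J: "J \<subseteq> {..<length F}" "J \<noteq> {}" for J s
  proof -
    have finJ: "finite J" using J(1) finite_subset by blast
    have mem: "F ! j \<in> set F" if "j \<in> J" for j using J(1) that by auto
    have eq: "restricted_gains F p J s = gain F p J s ` ?W J"
      using restricted_gains_eq_cells[OF assms(1) finJ J(2)] A mem by blast
    have fin: "finite (restricted_gains F p J s)"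
      unfolding restricted_gains_def using finJ by (simp add: finite_outcomes)
    obtain j where j: "j \<in> J" using J(2) by blast
    have "snd (F ! j) \<noteq> bot" using ce mem[OF j] by (auto simp: is_cond_event_def)
    then obtain D where "D \<in> cells A" "D \<le> snd (F ! j)"
      using cell_below[OF assms(1)] by blast
    then have ne: "restricted_gains F p J s \<noteq> {}" unfolding eq using j by blast
    show ?thesis
      using Min_le_iff[OF fin ne, of 0] Max_ge_iff[OF fin ne, of 0]
      unfolding gain_uminus eq by simp
  qed
  show ?thesis
  proof
    assume "coherent F p"
    then have len: "length p = length F"
      and "\<And>J s. J \<subseteq> {..<length F} \<Longrightarrow> J \<noteq> {} \<Longrightarrow> 0 \<le> Max (restricted_gains F p J s)"
      by (auto simp: coherent_def)
    then have "\<exists>D\<in>?W J. 0 \<le> gain F p J s D" if "J \<subseteq> {..<length F}" "J \<noteq> {}" for J s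
      using main[OF that] that by blast
    with len show "length p = length F \<and> (\<forall>J s. J \<subseteq> {..<length F} \<and> J \<noteq> {} \<longrightarrow>
      (\<exists>D\<in>cells A. (\<exists>j\<in>J. D \<le> snd (F ! j)) \<and> 0 \<le> gain F p J s D))"
      by (simp add: Bex_def conj_assoc)
  next
    assume R: "length p = length F \<and> (\<forall>J s. J \<subseteq> {..<length F} \<and> J \<noteq> {} \<longrightarrow>
      (\<exists>D\<in>cells A. (\<exists>j\<in>J. D \<le> snd (F ! j)) \<and> 0 \<le> gain F p J s D))"
    have W: "\<exists>D\<in>?W J. 0 \<le> gain F p J s D" if "J \<subseteq> {..<length F}" "J \<noteq> {}" for J s
      using R that by blast
    show "coherent F p"
      unfolding coherent_def using R main W by simp
  qed
qed

section \<open>Outcomes that falsify none of the chosen conditional events\<close>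

definition nonfalsifying :: "'a::boolean_algebra cond_event list \<Rightarrow> nat set \<Rightarrow> 'a \<Rightarrow> bool" where
  "nonfalsifying F J D \<longleftrightarrow> (\<forall>j\<in>J. D \<le> snd (F ! j) \<longrightarrow> D \<le> fst (F ! j))"

definition compatible ::
  "'a::boolean_algebra set \<Rightarrow> 'a cond_event list \<Rightarrow> nat set \<Rightarrow> 'a \<Rightarrow> bool" where
  "compatible A F J X \<longleftrightarrow> (\<exists>D\<in>cells A. D \<le> X \<and> nonfalsifying F J D)"

text \<open>
  The quasi conjunction of the \<open>E\<^sub>j|H\<^sub>j\<close>, for \<open>j\<close> in \<open>J\<close>, can be true together with \<open>X\<close>. The
  true \<open>H\<^sub>j\<close> matters because a bet on \<open>J\<close> alone is judged only on outcomes where it is not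
  called off.
\<close>

definition compatible_active ::
  "'a::boolean_algebra set \<Rightarrow> 'a cond_event list \<Rightarrow> nat set \<Rightarrow> 'a \<Rightarrow> bool" where
  "compatible_active A F J X \<longleftrightarrow>
    (\<exists>D\<in>cells A. D \<le> X \<and> nonfalsifying F J D \<and> (\<exists>j\<in>J. D \<le> snd (F ! j)))"

lemma nonfalsifying_Un:
  "nonfalsifying F (J \<union> K) D \<longleftrightarrow> nonfalsifying F J D \<and> nonfalsifying F K D"
  by (auto simp: nonfalsifying_def)

text \<open>
  If every outcome relevant to \<open>J\<close> falsified some \<open>E\<^sub>j|H\<^sub>j\<close>, then unit stakes would lose at
  least 1/2 on that one and win less than 1/2 on all the others together, once all probabilities
  are at least \<open>1 - 1/(2n)\<close>.
\<close>

lemma p_consistent_imp_active: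
  assumes "finite A" and ce: "\<forall>c\<in>set F. is_cond_event c"
    and A: "\<forall>c\<in>set F. fst c \<in> A \<and> snd c \<in> A"
    and pc: "p_consistent F"
    and J: "J \<subseteq> {..<length F}" "J \<noteq> {}"
  shows "compatible_active A F J top"
proof (rule ccontr)
  assume no: "\<not> ?thesis"
  define n where "n = length F"
  have npos: "n > 0" using J by (auto simp: n_def)
  define e where "e = 1 / (2 * real n)"
  have e: "0 < e" "e < 1" "real n * e = 1/2" using npos by (auto simp: e_def field_simps)
  have "\<exists>p. coherent F p \<and> (\<forall>i<length F. replicate n (1 - e) ! i \<le> p ! i)"
    using pc[unfolded p_consistent_def, rule_format, of "replicate n (1 - e)"] e
    by (simp add: n_def)
  then obtain p where p: "coherent F p" "\<And>i. i < n \<Longrightarrow> 1 - e \<le> p ! i"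
    by (auto simp: n_def)
  obtain D where D: "D \<in> cells A" "\<exists>j\<in>J. D \<le> snd (F ! j)" "0 \<le> gain F p J (\<lambda>_. 1) D"
    using p(1) J unfolding coherent_iff_cells[OF assms(1) ce A] by blast
  have "\<not> nonfalsifying F J D"
    using no D by (auto simp: compatible_active_def)
  then obtain k where k: "k \<in> J" "D \<le> snd (F ! k)" "\<not> D \<le> fst (F ! k)"
    by (auto simp: nonfalsifying_def)
  have finJ: "finite J" using J(1) finite_subset by blast
  have Jn: "card J \<le> n" using card_mono[OF _ J(1)] by (simp add: n_def)
  have "gain F p J (\<lambda>_. 1) D \<le> (\<Sum>j\<in>J. if j = k then e - 1 else e)"
    unfolding gain_def
  proof (rule sum_mono)
    fix j assume "j \<in> J"
    then have "1 - e \<le> p ! j" using J(1) p(2) by (auto simp: n_def)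
    then show "1 * ind (snd (F ! j)) D * (ind (fst (F ! j)) D - p ! j) \<le> (if j = k then e - 1 else e)"
      using k e by (auto simp: ind_def)
  qed
  also have "\<dots> = (\<Sum>j\<in>J. e - (if j = k then 1 else 0))"
    by (intro sum.cong) auto
  also have "\<dots> = real (card J) * e - 1"
    using finJ k(1) by (simp add: sum_subtractf)
  also have "\<dots> \<le> real n * e - 1" using Jn e(1) by simp
  also have "\<dots> < 0" using e(3) by simp
  finally show False using D(3) by simp
qed

text \<open>
  Two sets \<open>J\<close> and \<open>K\<close> that constrain \<open>z\<close> cannot force different values: take an outcome
  that falsifies nothing in \<open>J \<union> K\<close> and is active there. If it made \<open>E|H\<close> void, it would
  relieve \<open>J\<close> or \<open>K\<close> of its constraint, according to where it is active; hence it gives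
  \<open>E|H\<close> a truth value, which \<open>J\<close> and \<open>K\<close> then both admit. If \<open>J\<close> and \<open>K\<close> are empty, any
  outcome that implies \<open>H\<close> will do.
\<close>

lemma compatible_dichotomy:
  fixes E H :: "'a::boolean_algebra"
  assumes "finite A" "E \<in> A" "H \<in> A" "H \<noteq> bot"
    and active: "\<And>J. J \<subseteq> {..<n} \<Longrightarrow> J \<noteq> {} \<Longrightarrow> compatible_active A F J top"
    and J: "J \<subseteq> {..<n}" "\<not> compatible_active A F J (- H)"
    and K: "K \<subseteq> {..<n}" "\<not> compatible_active A F K (- H)"
  shows "(compatible A F J (inf E H) \<and> compatible A F K (inf E H)) \<or>
         (compatible A F J (inf (- E) H) \<and> compatible A F K (inf (- E) H))"
proof -
  have "\<exists>D\<in>cells A. D \<le> H \<and> nonfalsifying F (J \<union> K) D"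
  proof (cases "J \<union> K = {}")
    case True
    then show ?thesis
      using cell_below[OF assms(1,4)] by (auto simp: nonfalsifying_def)
  next
    case False
    then obtain D where D: "D \<in> cells A" "nonfalsifying F (J \<union> K) D"
        "\<exists>j\<in>J \<union> K. D \<le> snd (F ! j)"
      using active[of "J \<union> K"] J K by (auto simp: compatible_active_def)
    have "D \<le> H"
    proof (rule ccontr)
      assume "\<not> D \<le> H"
      then have "D \<le> - H" using cells_decide[OF D(1) assms(3)] by simp
      then show False
        using D J(2) K(2) by (auto simp: compatible_active_def nonfalsifying_Un)
    qed
    then show ?thesis using D by blast
  qed
  then obtain D where D: "D \<in> cells A" "D \<le> H" "nonfalsifying F J D" "nonfalsifying F K D"
    by (auto simp: nonfalsifying_Un)
  show ?thesis
    using D cells_decide[OF D(1) assms(2)] unfolding compatible_def by (meson le_inf_iff)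
qed

section \<open>Assessments with all probabilities but one equal to 1\<close>

lemma gain_ones_nonfalsifying:
  assumes "J \<subseteq> {..<length F}" "nonfalsifying F J D"
  shows "gain (F @ G) (replicate (length F) 1 @ q) J s D = 0"
  unfolding gain_def
proof (intro sum.neutral ballI)
  fix j assume j: "j \<in> J"
  then have "j < length F" using assms(1) by blast
  then show "s j * ind (snd ((F @ G) ! j)) D *
      (ind (fst ((F @ G) ! j)) D - (replicate (length F) 1 @ q) ! j) = 0"
    using assms(2) j by (auto simp: nth_append ind_def nonfalsifying_def)
qed

lemma gain_ones_falsifying:
  assumes "J \<subseteq> {..<length F}" "\<not> nonfalsifying F J D" "\<And>j. j \<in> J \<Longrightarrow> s j = c" "0 \<le> c"
  shows "gain (F @ G) (replicate (length F) 1 @ q) J s D \<le> - c"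
proof -
  obtain k where k: "k \<in> J" "D \<le> snd (F ! k)" "\<not> D \<le> fst (F ! k)"
    using assms(2) by (auto simp: nonfalsifying_def)
  have finJ: "finite J" using assms(1) finite_subset by blast
  have "gain (F @ G) (replicate (length F) 1 @ q) J s D \<le> (\<Sum>j\<in>J. if j = k then - c else 0)"
    unfolding gain_def
  proof (rule sum_mono)
    fix j assume j: "j \<in> J"
    then have "j < length F" using assms(1) by blast
    then show "s j * ind (snd ((F @ G) ! j)) D *
        (ind (fst ((F @ G) ! j)) D - (replicate (length F) 1 @ q) ! j) \<le> (if j = k then - c else 0)"
      using k j assms(3,4) by (auto simp: nth_append ind_def)
  qed
  also have "\<dots> = - c" using finJ k(1) by simp
  finally show ?thesis .
qed

lemma gain_insert_last:
  assumes "finite J" "length F \<notin> J" "length p = length F"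
  shows "gain (F @ [(E, H)]) (p @ [z]) (insert (length F) J) s D =
    s (length F) * ind H D * (ind E D - z) + gain (F @ [(E, H)]) (p @ [z]) J s D"
  using assms by (simp add: gain_def nth_append)

text \<open>
  For necessity, stakes 2 on the events of \<open>J\<close> make every outcome that falsifies one of them a
  loss, whatever a unit bet on \<open>E|H\<close> brings, since that bet wins at most 1; the sign of the latter
  bet tests whether \<open>z\<close> is too small or too large.
\<close>

lemma coherent_ones_iff:
  fixes E H :: "'a::boolean_algebra"
  assumes fin: "finite A" and ce: "\<forall>c\<in>set F. is_cond_event c"
    and A: "\<forall>c\<in>set F. fst c \<in> A \<and> snd c \<in> A"
    and EH: "E \<in> A" "H \<in> A" "H \<noteq> bot"
    and active: "\<And>J. J \<subseteq> {..<length F} \<Longrightarrow> J \<noteq> {} \<Longrightarrow> compatible_active A F J top"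
  shows "coherent (F @ [(E, H)]) (replicate (length F) 1 @ [z]) \<longleftrightarrow>
    0 \<le> z \<and> z \<le> 1 \<and>
    (\<forall>J\<subseteq>{..<length F}. compatible_active A F J (- H) \<or>
      (z = 1 \<or> compatible A F J (inf (- E) H)) \<and> (z = 0 \<or> compatible A F J (inf E H)))"
    (is "?coh \<longleftrightarrow> ?rhs")
proof -
  let ?n = "length F" and ?G = "F @ [(E, H)]" and ?p = "replicate (length F) 1 @ [z]"
  have G: "\<forall>c\<in>set ?G. is_cond_event c" "\<forall>c\<in>set ?G. fst c \<in> A \<and> snd c \<in> A"
    using ce A EH by (auto simp: is_cond_event_def)
  note coh_iff = coherent_iff_cells[OF fin G, of ?p]
  have gain_ins: "gain ?G ?p (insert ?n J) s D =
      s ?n * ind H D * (ind E D - z) + gain ?G ?p J s D" if "J \<subseteq> {..<?n}" for J s D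
    using that finite_subset by (intro gain_insert_last) auto
  have gain0: "gain ?G ?p J s D = 0" if "J \<subseteq> {..<?n}" "nonfalsifying F J D" for J s D
    using gain_ones_nonfalsifying that by blast
  show ?thesis
  proof
    assume ?coh
    then have coh: "\<exists>D\<in>cells A. (\<exists>j\<in>J. D \<le> snd (?G ! j)) \<and> 0 \<le> gain ?G ?p J s D"
      if "J \<subseteq> {..?n}" "J \<noteq> {}" for J s
      using that coh_iff by (auto simp: lessThan_Suc_atMost)
    have single: "\<exists>D\<in>cells A. D \<le> H \<and> 0 \<le> t * (ind E D - z)" for t
      using coh[of "{?n}" "\<lambda>_. t"] by (auto simp: gain_def ind_def nth_append)
    have z: "0 \<le> z" "z \<le> 1"
      using single[of "-1"] single[of 1] by (auto simp: ind_def of_bool_def split: if_splits)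
    (* A unit bet t on E|H, protected by the stakes on J, can only be saved by an outcome of this kind. *)
    have test: "\<exists>D\<in>cells A. D \<le> H \<and> nonfalsifying F J D \<and> 0 \<le> t * (ind E D - z)"
      if J: "J \<subseteq> {..<?n}" "\<not> compatible_active A F J (- H)" and t: "\<bar>t\<bar> = 1" for J and t :: real
    proof -
      define s :: "nat \<Rightarrow> real" where "s j = (if j = ?n then t else 2)" for j
      obtain D where D: "D \<in> cells A" "\<exists>j\<in>insert ?n J. D \<le> snd (?G ! j)"
          "0 \<le> gain ?G ?p (insert ?n J) s D"
        using coh[of "insert ?n J" s] J(1) by (force simp: subset_iff)
      have g: "0 \<le> t * ind H D * (ind E D - z) + gain ?G ?p J s D"
        using D(3) gain_ins[OF J(1)] by (simp add: s_def)
      have bet: "t * ind H D * (ind E D - z) \<le> 1"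
        using t z by (auto simp: ind_def abs_if split: if_splits)
      have nf: "nonfalsifying F J D"
      proof (rule ccontr)
        assume "\<not> nonfalsifying F J D"
        then have "gain ?G ?p J s D \<le> - 2"
          using J(1) by (intro gain_ones_falsifying) (auto simp: s_def)
        then show False using g bet by linarith
      qed
      have "D \<le> H"
      proof (rule ccontr)
        assume H: "\<not> D \<le> H"
        then have "D \<le> - H" using cells_decide[OF D(1) EH(2)] by simp
        moreover obtain j where "j \<in> J" "D \<le> snd (F ! j)"
          using D(2) H J(1) by (auto simp: nth_append subset_iff split: if_splits)
        ultimately show False using J(2) nf D(1) by (auto simp: compatible_active_def)
      qed
      moreover have "0 \<le> t * (ind E D - z)"
        using g gain0[OF J(1) nf] \<open>D \<le> H\<close> by (simp add: ind_def)
      ultimately show ?thesis using D(1) nf by blast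
    qed
    have "z = 1 \<or> compatible A F J (inf (- E) H)" "z = 0 \<or> compatible A F J (inf E H)"
      if J: "J \<subseteq> {..<?n}" "\<not> compatible_active A F J (- H)" for J
    proof -
      obtain D where D: "D \<in> cells A" "D \<le> H" "nonfalsifying F J D" "0 \<le> (-1) * (ind E D - z)"
        using test[OF J, of "-1"] by auto
      have "z = 1 \<or> \<not> D \<le> E" using D(4) z by (auto simp: ind_def)
      then show "z = 1 \<or> compatible A F J (inf (- E) H)"
        using D cells_decide[OF D(1) EH(1)] by (auto simp: compatible_def)
    next
      obtain D where D: "D \<in> cells A" "D \<le> H" "nonfalsifying F J D" "0 \<le> 1 * (ind E D - z)"
        using test[OF J, of 1] by auto
      have "z = 0 \<or> D \<le> E" using D(4) z by (auto simp: ind_def split: if_splits)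
      then show "z = 0 \<or> compatible A F J (inf E H)"
        using D by (auto simp: compatible_def)
    qed
    then show ?rhs using z by blast
  next
    assume R: ?rhs
    have "\<exists>D\<in>cells A. (\<exists>j\<in>J. D \<le> snd (?G ! j)) \<and> 0 \<le> gain ?G ?p J s D"
      if J: "J \<subseteq> {..?n}" "J \<noteq> {}" for J s
    proof (cases "?n \<in> J")
      case False
      then have J': "J \<subseteq> {..<?n}" using J(1) by (auto simp: subset_iff order.strict_iff_order)
      obtain D j where D: "D \<in> cells A" "nonfalsifying F J D" "j \<in> J" "D \<le> snd (F ! j)"
        using active[OF J' J(2)] by (auto simp: compatible_active_def)
      have "snd (?G ! j) = snd (F ! j)" using D(3) J' by (auto simp: nth_append)
      then show ?thesis using D gain0[OF J' D(2)] by (metis order_refl)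
    next
      case True
      define K where "K = J - {?n}"
      have K: "K \<subseteq> {..<?n}" and JK: "J = insert ?n K"
        using J(1) True by (auto simp: K_def subset_iff order.strict_iff_order)
      show ?thesis
      proof (cases "compatible_active A F K (- H)")
        case True
        then obtain D j where D: "D \<in> cells A" "D \<le> - H" "nonfalsifying F K D" "j \<in> K"
            "D \<le> snd (F ! j)"
          by (auto simp: compatible_active_def)
        have "ind H D = 0" using D cells_decide[OF D(1) EH(2)] by (simp add: ind_def)
        then have "gain ?G ?p J s D = 0" using gain_ins[OF K] gain0[OF K D(3)] by (simp add: JK)
        moreover have "snd (?G ! j) = snd (F ! j)" using D(4) K by (auto simp: nth_append)
        ultimately show ?thesis using D JK by (metis insertI2 order_refl)
      next
        case False
        then have B: "z = 1 \<or> compatible A F K (inf (- E) H)" "z = 0 \<or> compatible A F K (inf E H)"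
          using R K by auto
        have z: "0 \<le> z" "z \<le> 1" using R by auto
        have betE: "\<exists>D\<in>cells A. D \<le> H \<and> nonfalsifying F K D \<and> ind E D = 1"
          if "compatible A F K (inf E H)"
          using that by (auto simp: compatible_def ind_def)
        have betnE: "\<exists>D\<in>cells A. D \<le> H \<and> nonfalsifying F K D \<and> ind E D = 0"
          if "compatible A F K (inf (- E) H)"
          using that cells_decide[OF _ EH(1)] by (auto simp: compatible_def ind_def)
        have "\<exists>D\<in>cells A. D \<le> H \<and> nonfalsifying F K D \<and> 0 \<le> s ?n * (ind E D - z)"
        proof (cases "0 \<le> s ?n")
          case True
          show ?thesis
          proof (cases "z = 0")
            case True
            then show ?thesis using B betnE by fastforce
          next
            case False
            then show ?thesis using B betE z \<open>0 \<le> s ?n\<close> by fastforce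
          qed
        next
          case False
          show ?thesis
          proof (cases "z = 1")
            case True
            then show ?thesis using B betE by fastforce
          next
            case z1: False
            then obtain D where D: "D \<in> cells A" "D \<le> H" "nonfalsifying F K D" "ind E D = 0"
              using B betnE by blast
            have "0 \<le> s ?n * (ind E D - z)" 
              unfolding D(4) using z False by (intro mult_nonpos_nonpos) auto
            then show ?thesis using D by blast
          qed
        qed
        then obtain D where D: "D \<in> cells A" "D \<le> H" "nonfalsifying F K D"
            "0 \<le> s ?n * (ind E D - z)"
          by blast
        have "0 \<le> gain ?G ?p J s D"
          using D gain_ins[OF K] gain0[OF K D(3)] by (simp add: JK ind_def)
        then show ?thesis using D by (auto simp: JK nth_append)
      qed
    qed
    then show ?coh unfolding coh_iff by (simp add: lessThan_Suc_atMost)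
  qed
qed

theorem theorem8:
  fixes F :: "'a::boolean_algebra cond_event list" and n :: nat and E H :: 'a
  assumes "length F = n"
    and "\<forall>c\<in>set F. is_cond_event c"
    and "p_consistent F"
    and "is_cond_event (E, H)"
  shows "let coh = (\<lambda>z::real. coherent (F @ [(E, H)]) (replicate n 1 @ [z]));
             a1 = (\<forall>z. coh z \<longleftrightarrow> z = 1);
             a2 = (\<forall>z\<in>{0..1}. coh z);
             a3 = (\<forall>z. coh z \<longleftrightarrow> z = 0)
         in (a1 \<or> a2 \<or> a3) \<and> \<not> (a1 \<and> a2) \<and> \<not> (a1 \<and> a3) \<and> \<not> (a2 \<and> a3)"
proof -
  define A where "A = {E, H} \<union> fst ` set F \<union> snd ` set F"
  define coh where "coh z \<longleftrightarrow> coherent (F @ [(E, H)]) (replicate n 1 @ [z])" for z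
  have A: "finite A" "\<forall>c\<in>set F. fst c \<in> A \<and> snd c \<in> A" and EH: "E \<in> A" "H \<in> A" "H \<noteq> bot"
    using assms(4) by (auto simp: A_def is_cond_event_def)
  have active: "compatible_active A F J top" if "J \<subseteq> {..<length F}" "J \<noteq> {}" for J
    using p_consistent_imp_active[OF A(1) assms(2) A(2) assms(3) that] .
  let ?v = "\<lambda>J. compatible_active A F J (- H)"
    and ?f = "\<lambda>J. compatible A F J (inf (- E) H)" and ?t = "\<lambda>J. compatible A F J (inf E H)"
  have coh: "coh z \<longleftrightarrow> 0 \<le> z \<and> z \<le> 1 \<and>
      (\<forall>J\<subseteq>{..<n}. ?v J \<or> (z = 1 \<or> ?f J) \<and> (z = 0 \<or> ?t J))" for z
    using coherent_ones_iff[OF A(1) assms(2) A(2) EH active, of z] assms(1)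
    by (simp add: coh_def)
  have two: "?t J \<and> ?t K \<or> ?f J \<and> ?f K" if "J \<subseteq> {..<n}" "\<not> ?v J" "K \<subseteq> {..<n}" "\<not> ?v K" for J K
    using compatible_dichotomy[OF A(1) EH, of n F J K] active assms(1) that by simp
  have one_or_all: "(\<forall>z. coh z \<longleftrightarrow> z = 1) \<or> (\<forall>z\<in>{0..1}. coh z) \<or> (\<forall>z. coh z \<longleftrightarrow> z = 0)"
  proof (cases "\<exists>J\<subseteq>{..<n}. \<not> ?v J \<and> \<not> (?t J \<and> ?f J)")
    case False
    then have "\<forall>z\<in>{0..1}. coh z" by (auto simp: coh)
    then show ?thesis by blast
  next
    case True
    then obtain J where J: "J \<subseteq> {..<n}" "\<not> ?v J" "\<not> (?t J \<and> ?f J)" by blast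
    show ?thesis
    proof (cases "?t J")
      case True
      then have "\<not> ?f J" using J(3) by blast
      then have "?v K \<or> ?t K" if "K \<subseteq> {..<n}" for K
        using two[OF J(1,2) that] by blast
      then have "\<forall>z. coh z \<longleftrightarrow> z = 1"
        using J \<open>\<not> ?f J\<close> by (auto simp: coh)
      then show ?thesis by blast
    next
      case False
      then have "?v K \<or> ?f K" if "K \<subseteq> {..<n}" for K
        using two[OF J(1,2) that] by blast
      then have "\<forall>z. coh z \<longleftrightarrow> z = 0"
        using J False by (auto simp: coh)
      then show ?thesis by blast
    qed
  qed
  have "coh 0 \<and> coh 1" if "\<forall>z\<in>{0..1}. coh z"
    using that by simp
  then show ?thesis
    using one_or_all unfolding Let_def coh_def[symmetric] by (metis zero_neq_one)
qed

end
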